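(* For every integer $k\ge 1$ and for every field $\mathbb{F}$, \[ m(k,\mathbb{F}) > \sum_{i=1}^{k-1}\Big\lfloor \frac{k-1}{i} \Big\rfloor .\] In particular, for every field $\mathbb{F}$ it holds that $m(k,\mathbb{F}) = \Omega(k \cdot \log k)$.
   Context: Inner product: on $\mathbb{C}^t$, $\langle x,y\rangle=\sum_i x_i\overline{y_i}$; on $\mathbb{F}^t$ for every other field $\mathbb{F}$ (in particular $\mathbb{R}$ and finite fields), $\langle x,y\rangle=\sum_i x_iy_i$. A finite simple graph $G=(V,E)$ is $k$-subspace choosable over $\mathbb{F}$ if for every integer $t$ and every assignment of subspaces $W_v\subseteq\mathbb{F}^t$ with $\dim(W_v)=k$ to the vertices $v\in V$, there exists a choice of a nonzero vector $x_v\in W_v$ for each $v\in V$ such that $\langle x_v,x_{v'}\rangle=0$ whenever $v$ and $v'$ are adjacent in $G$. The subspace choice number $\mathrm{ch\text{-}s}(G,\mathbb{F})$ is the smallest positive integer $k$ for which $G$ is $k$-subspace choosable over $\mathbb{F}$. $K_{k,m}$ is the complete bipartite graph with $k$ vertices on the left side and $m$ on the right side. It always satisfies $\mathrm{ch\text{-}s}(K_{k,m},\mathbb{F})\le k+1$. For an integer $k$ and a field $\mathbb{F}$, $m(k,\mathbb{F})$ denotes the smallest integer $m$ for which $\mathrm{ch\text{-}s}(K_{k,m},\mathbb{F})=k+1$. *)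

theory Defs
  imports
    "Graph_Theory.Kuratowski"
    "Jordan_Normal_Form.Conjugate"
    "Jordan_Normal_Form.VS_Connect"
    "HOL-Library.Landau_Symbols"
begin

text \<open>
  The inner product on the spaces \<open>F^t\<close> is a parameter \<open>ip\<close> of the following notions, since it is
  Hermitian over the complex numbers and bilinear over all other fields.  The two values that
  are used are the library's \<open>(\<bullet>c)\<close> (conjugate in the second argument) and \<open>(\<bullet>)\<close>.

  Finite simple graphs are the library's \<open>pair_graph\<close>s: an undirected edge is
  represented by the two opposite arcs.
\<close>

lemma cscalar_prod_complex_eq:
  fixes x y :: "complex vec"
  assumes "y \<in> carrier_vec t"
  shows "x \<bullet>c y = (\<Sum>i<t. x $ i * cnj (y $ i))"
  using assms by (simp add: scalar_prod_def lessThan_atLeast0)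

definition subspace_choosable ::
  "('a :: field vec \<Rightarrow> 'a vec \<Rightarrow> 'a) \<Rightarrow> 'v pair_pre_digraph \<Rightarrow> nat \<Rightarrow> bool" where
  "subspace_choosable ip G k \<longleftrightarrow>
    (\<forall>t. \<forall>W :: 'v \<Rightarrow> 'a vec set.
      (\<forall>v \<in> pverts G. subspace class_ring (W v) (module_vec TYPE('a) t) \<and>
          vectorspace.dim class_ring ((module_vec TYPE('a) t)\<lparr>carrier := W v\<rparr>) = k) \<longrightarrow>
      (\<exists>x :: 'v \<Rightarrow> 'a vec.
        (\<forall>v \<in> pverts G. x v \<in> W v \<and> x v \<noteq> 0\<^sub>v t) \<and>
        (\<forall>(v, w) \<in> parcs G. ip (x v) (x w) = 0)))"

definition ch_s :: "('a :: field vec \<Rightarrow> 'a vec \<Rightarrow> 'a) \<Rightarrow> 'v pair_pre_digraph \<Rightarrow> nat" where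
  "ch_s ip G = (LEAST k. 1 \<le> k \<and> subspace_choosable ip G k)"

definition complete_bipartite :: "nat \<Rightarrow> nat \<Rightarrow> (nat + nat) pair_pre_digraph" where
  "complete_bipartite k m =
    \<lparr>pverts = Inl ` {..<k} \<union> Inr ` {..<m},
     parcs = Inl ` {..<k} \<times> Inr ` {..<m} \<union> Inr ` {..<m} \<times> Inl ` {..<k}\<rparr>"

lemma complete_bipartite_is_K: "K\<^bsub>k,m\<^esub> (with_proj (complete_bipartite k m))"
proof -
  have "card (Inl ` {..<k} :: (nat + nat) set) = k" "card (Inr ` {..<m} :: (nat + nat) set) = m"
    by (simp_all add: card_image)
  moreover have "Inl ` {..<k} \<inter> Inr ` {..<m} = ({} :: (nat + nat) set)"
    by auto
  ultimately show ?thesis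
    unfolding complete_bipartite_digraph_pair_def
    by (intro conjI exI[of _ "Inl ` {..<k}"] exI[of _ "Inr ` {..<m}"])
      (simp_all add: complete_bipartite_def)
qed

lemma pair_graph_complete_bipartite: "pair_graph (complete_bipartite k m)"
  using complete_bipartite_is_K by (rule pair_graphI_complete_bipartite)

text \<open>
  For \<open>k \<ge> 1\<close> and both inner products such an \<open>m\<close> exists, e.g. \<open>m = k ^ k\<close>: take the left subspaces
  to be the \<open>k\<close> blocks of coordinates of \<open>F ^ (k * k)\<close>, and the right ones to be all spans of
  \<open>k\<close> standard unit vectors, one from each block.  Hence \<open>LEAST\<close> is a genuine minimum here.
\<close>

definition m_ch :: "('a :: field vec \<Rightarrow> 'a vec \<Rightarrow> 'a) \<Rightarrow> nat \<Rightarrow> nat" where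
  "m_ch ip k = (LEAST m. ch_s ip (complete_bipartite k m) = k + 1)"

end

theory Submission
  imports Defs
begin

text \<open>
  Fix a right vertex with space \<open>U\<close> of dimension \<open>k\<close>.  The left vectors \<open>x\<^sub>0, \<dots>, x\<^sub>k\<^sub>-\<^sub>1\<close> are good for it
  when \<open>U\<close> contains a nonzero vector orthogonal to all of them.  Each left vector costs at most one
  dimension of \<open>U\<close>, so \<open>k\<close> left vectors are one too many, and it suffices that one of them costs
  nothing.  Just before \<open>x\<^sub>n\<close> is chosen, at least \<open>i = k - n\<close> dimensions of \<open>U\<close> are left.  If \<open>x\<^sub>n\<close>
  is orthogonal to \<open>i\<close> independent vectors among what is left, then these \<open>i\<close> dimensions survive and
  \<open>x\<^sub>n\<close> costs nothing; this amounts to \<open>i\<close> linear conditions on \<open>x\<^sub>n\<close>.  Since \<open>x\<^sub>n\<close> ranges over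
  a space of dimension \<open>k\<close>, it can be nonzero and satisfy \<open>k - 1\<close> conditions, and so serve
  \<open>\<lfloor>(k - 1) / i\<rfloor>\<close> right vertices.  In total
  \<open>\<Sum>i. \<lfloor>(k - 1) / i\<rfloor>\<close> right vertices can be served, whence \<open>K\<^bsub>k,m\<^esub>\<close> is \<open>k\<close>-subspace choosable for
  every such \<open>m\<close>.  This is the content of \<open>choosable_of_schedule\<close>, where \<open>s j\<close> is the number of
  dimensions that the left vector serving the right vertex \<open>j\<close> has to respect.

  The number \<open>m(k)\<close> is a minimum only if \<open>K\<^bsub>k,m\<^esub>\<close> has choice number \<open>k + 1\<close> for some \<open>m\<close>.  This
  holds for \<open>m = k ^ k\<close> (\<open>ch_s_attains_maximum\<close>): let the left spaces be spanned by disjoint blocks of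
  \<open>k\<close> unit vectors and the right spaces by the transversals of the blocks.

  The growth of the bound is that of \<open>k\<close> times a harmonic sum (\<open>harmonic_floor_sum_bigomega\<close>).
  Both inner products are treated at once, as sums \<open>\<Sum>l. x\<^sub>l \<sigma>(y\<^sub>l)\<close> with an involutive field
  automorphism \<open>\<sigma>\<close>, the identity or complex conjugation.
\<close>

section \<open>Independent sets in subspaces of coordinate spaces\<close>

abbreviation subspace_of_dim :: "nat \<Rightarrow> nat \<Rightarrow> 'a :: field vec set \<Rightarrow> bool" where
  "subspace_of_dim t d W \<equiv>
    subspace class_ring W (module_vec TYPE('a) t) \<and>
    vectorspace.dim class_ring ((module_vec TYPE('a) t)\<lparr>carrier := W\<rparr>) = d"

abbreviation independent :: "nat \<Rightarrow> 'a :: field vec set \<Rightarrow> bool" where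
  "independent t \<equiv> module.lin_indpt class_ring (module_vec TYPE('a) t)"

context vec_space
begin

text \<open>
  Independence read off coordinate by coordinate, so that it can be checked by computing with sums in
  the field.
\<close>
lemma lin_indpt_iff_coeffs:
  assumes "finite B" "B \<subseteq> carrier_vec n"
  shows "lin_indpt B \<longleftrightarrow>
    (\<forall>c. (\<forall>i<n. (\<Sum>b\<in>B. c b * b $ i) = 0) \<longrightarrow> (\<forall>b\<in>B. c b = 0))"
proof -
  have "lincomb c B = 0\<^sub>v n \<longleftrightarrow> (\<forall>i<n. (\<Sum>b\<in>B. c b * b $ i) = 0)" for c
  proof -
    have "lincomb c B \<in> carrier_vec n"
      using assms(2) by simp
    then show ?thesis
      using lincomb_index[OF _ assms(2), of _ c] by (auto simp: vec_eq_iff)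
  qed
  moreover have "lin_dep B \<longleftrightarrow> (\<exists>c. lincomb c B = 0\<^sub>v n \<and> (\<exists>b\<in>B. c b \<noteq> 0))"
    using finite_lin_dep[OF assms(1)] assms lin_dep_crit[OF assms(1) subset_refl] by auto
  ultimately show ?thesis
    by blast
qed

lemma subspace_closed:
  assumes "subspace class_ring S V"
  shows "S \<subseteq> carrier_vec n" "0\<^sub>v n \<in> S"
    "u \<in> S \<Longrightarrow> v \<in> S \<Longrightarrow> u + v \<in> S" "u \<in> S \<Longrightarrow> c \<cdot>\<^sub>v u \<in> S"
proof -
  interpret submodule class_ring S V
    using assms by (rule is_module)
  show "S \<subseteq> carrier_vec n" "0\<^sub>v n \<in> S"
    "u \<in> S \<Longrightarrow> v \<in> S \<Longrightarrow> u + v \<in> S" "u \<in> S \<Longrightarrow> c \<cdot>\<^sub>v u \<in> S"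
    using subset zero_closed m_closed smult_closed
    by (auto simp: module_vec_simps class_ring_simps)
qed

lemma subspaceI:
  assumes "S \<subseteq> carrier_vec n" "0\<^sub>v n \<in> S"
    "\<And>u v. u \<in> S \<Longrightarrow> v \<in> S \<Longrightarrow> u + v \<in> S" "\<And>u c. u \<in> S \<Longrightarrow> c \<cdot>\<^sub>v u \<in> S"
  shows "subspace class_ring S V"
proof -
  have "submodule class_ring S V"
    unfolding submodule_def
    using assms vec_module by (auto simp: module_vec_simps class_ring_simps)
  then show ?thesis
    using vec_vs by (simp add: subspace_def)
qed

text \<open>
  One linear condition costs at most one dimension.  If some \<open>p\<close> in \<open>B\<close> violates the condition, a
  multiple of \<open>p\<close> is subtracted from every other member of \<open>B\<close> so that the result satisfies it, and
  \<open>p\<close> itself is given up.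
\<close>
lemma lin_indpt_in_kernel:
  assumes S: "subspace class_ring S V"
    and B: "finite B" "B \<subseteq> S" "lin_indpt B"
    and add: "\<And>u v. u \<in> S \<Longrightarrow> v \<in> S \<Longrightarrow> \<phi> (u + v) = \<phi> u + \<phi> v"
    and smult: "\<And>c u. u \<in> S \<Longrightarrow> \<phi> (c \<cdot>\<^sub>v u) = c * \<phi> u"
  obtains C where "finite C" "C \<subseteq> {u \<in> S. \<phi> u = 0}" "lin_indpt C" "card B \<le> card C + 1"
proof (cases "\<forall>b\<in>B. \<phi> b = 0")
  case True
  then show ?thesis
    using that[of B] B by auto
next
  case False
  then obtain p where p: "p \<in> B" "\<phi> p \<noteq> 0"
    by blast
  have carr: "S \<subseteq> carrier_vec n"
    using subspace_closed(1)[OF S] .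
  have BV: "B \<subseteq> carrier_vec n"
    using B(2) carr by blast
  have dims: "dim_vec b = n" if "b \<in> B" for b
    using that BV by auto
  define r where "r b = b + (- (\<phi> b / \<phi> p)) \<cdot>\<^sub>v p" for b
  have rS: "r b \<in> S" if "b \<in> B" for b
    unfolding r_def using that B(2) p(1) subspace_closed[OF S] by blast
  have r0: "\<phi> (r b) = 0" if "b \<in> B" for b
  proof -
    have "b \<in> S" "p \<in> S" "(- (\<phi> b / \<phi> p)) \<cdot>\<^sub>v p \<in> S"
      using that p(1) B(2) subspace_closed(4)[OF S] by blast+
    then show ?thesis
      unfolding r_def using p(2) by (simp add: add smult)
  qed
  have r_index: "r b $ i = b $ i - \<phi> b / \<phi> p * p $ i" if "i < n" for b i
    using that p(1) dims by (simp add: r_def)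
  have coeffs: "c b = 0"
    if c: "\<And>i. i < n \<Longrightarrow> (\<Sum>b\<in>B - {p}. c b * r b $ i) = 0" and b: "b \<in> B - {p}" for c b
  proof -
    \<comment> \<open>A relation among the corrected vectors is one among the members of \<open>B\<close>, once the
      multiples of \<open>p\<close> are collected.\<close>
    define d where "d q = (if q = p then - (\<Sum>b\<in>B - {p}. c b * (\<phi> b / \<phi> p)) else c q)" for q
    have "(\<Sum>q\<in>B. d q * q $ i) = 0" if i: "i < n" for i
    proof -
      have "(\<Sum>q\<in>B. d q * q $ i) = d p * p $ i + (\<Sum>b\<in>B - {p}. d b * b $ i)"
        using B(1) p(1) by (rule sum.remove)
      also have "\<dots> = (\<Sum>b\<in>B - {p}. c b * r b $ i)"
        by (simp add: d_def r_index i sum_distrib_left sum_distrib_right algebra_simps sum_subtractf)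
      finally show ?thesis
        using c[OF i] by simp
    qed
    then have "d b = 0"
      using B(3) b lin_indpt_iff_coeffs[OF B(1) BV] by blast
    then show ?thesis
      using b by (simp add: d_def)
  qed
  have inj: "inj_on r (B - {p})"
  proof (rule inj_onI, rule ccontr)
    fix a b assume ab: "a \<in> B - {p}" "b \<in> B - {p}" "r a = r b" "a \<noteq> b"
    define c where "c q = (if q = a then 1 else if q = b then - 1 else 0 :: 'a)" for q
    have "(\<Sum>q\<in>B - {p}. c q * r q $ i) = 0" if "i < n" for i
    proof -
      have "(\<Sum>q\<in>B - {p}. c q * r q $ i) = (\<Sum>q\<in>{a, b}. c q * r q $ i)"
        using ab B(1) by (intro sum.mono_neutral_right) (auto simp: c_def)
      also have "\<dots> = 0"
        using ab by (simp add: c_def)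
      finally show ?thesis .
    qed
    from coeffs[OF this ab(1)] show False
      by (simp add: c_def)
  qed
  define C where "C = r ` (B - {p})"
  have CS: "C \<subseteq> {u \<in> S. \<phi> u = 0}"
    using rS r0 by (auto simp: C_def)
  have "lin_indpt C"
  proof -
    have "c u = 0" if c: "\<forall>i<n. (\<Sum>u\<in>C. c u * u $ i) = 0" and u: "u \<in> C" for c u
    proof -
      obtain b where b: "b \<in> B - {p}" "u = r b"
        using u by (auto simp: C_def)
      have "(\<Sum>b\<in>B - {p}. (c \<circ> r) b * r b $ i) = 0" if "i < n" for i
        using c that by (simp add: C_def sum.reindex[OF inj])
      from coeffs[OF this b(1)] show ?thesis
        by (simp add: b(2))
    qed
    moreover have "finite C" "C \<subseteq> carrier_vec n"
      using CS carr B(1) by (auto simp: C_def)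
    ultimately show ?thesis
      using lin_indpt_iff_coeffs by blast
  qed
  moreover have "card B \<le> card C + 1"
    using B(1) p(1) by (simp add: C_def card_image[OF inj] card_Diff_singleton)
  ultimately show ?thesis
    using that[of C] B(1) CS by (simp add: C_def)
qed

text \<open>
  Independent subsets of \<open>W\<close> have at most \<open>n\<close> elements, so there is a maximal one, which is a basis.
  This also shows that \<open>W\<close> is finite-dimensional, without which \<open>dim\<close> would carry no information.
\<close>
lemma subspace_basis:
  assumes W: "subspace class_ring W V"
  obtains B where "finite B" "B \<subseteq> W" "lin_indpt B" "card B = vectorspace.dim class_ring (vs W)"
proof -
  have sub: "submodule class_ring W V"
    using W by (rule is_module)
  interpret W: vectorspace class_ring "vs W"
    using W by (rule subspace_is_vs)
  have WV: "W \<subseteq> carrier_vec n"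
    using subspace_closed(1)[OF W] .
  have indpt: "W.lin_indpt B \<longleftrightarrow> lin_indpt B" if "B \<subseteq> W" for B
    using span_li_not_depend(2)[OF that sub] by simp
  have "\<exists>B. finite B \<and> maximal B (\<lambda>S. S \<subseteq> W \<and> W.lin_indpt S)"
  proof (rule maximal_exists)
    show "finite B \<and> card B \<le> n" if "B \<subseteq> W \<and> W.lin_indpt B" for B
      using li_le_dim[of B] that indpt WV by (auto simp: dim_is_n)
    show "{} \<subseteq> W \<and> W.lin_indpt {}"
      by (simp add: W.lin_dep_def)
  qed
  then obtain B where B: "finite B" "maximal B (\<lambda>S. S \<subseteq> W \<and> W.lin_indpt S)"
    by blast
  then have basis: "W.basis B"
    using W.max_li_is_basis by simp
  then have "B \<subseteq> W" "W.lin_indpt B"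
    by (simp_all add: W.basis_def)
  then show ?thesis
    using that[of B] B(1) W.dim_basis[OF B(1) basis] indpt by simp
qed

lemma dim_span_lin_indpt:
  assumes B: "finite B" "B \<subseteq> carrier_vec n" "lin_indpt B"
  shows "vectorspace.dim class_ring (vs (span B)) = card B"
proof -
  have W: "subspace class_ring (span B) V"
    using B(2) by (simp add: span_is_subspace)
  then have sub: "submodule class_ring (span B) V"
    by (rule is_module)
  interpret W: vectorspace class_ring "vs (span B)"
    using W by (rule subspace_is_vs)
  have "B \<subseteq> span B"
    using B(2) in_own_span by simp
  then have "W.basis B"
    using span_li_not_depend[OF _ sub] B(3) by (simp add: W.basis_def)
  then show ?thesis
    using W.dim_basis B(1) by blast
qed

text \<open>
  The span of the unit vectors with index in \<open>I\<close>.  Both the left and the right spaces of the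
  assignment that defeats \<open>k\<close>-choosability are of this form.
\<close>
lemma coordinate_subspace:
  assumes I: "I \<subseteq> {..<n}"
  obtains W :: "'a vec set" where "subspace_of_dim n (card I) W"
    "\<And>x l. x \<in> W \<Longrightarrow> l < n \<Longrightarrow> l \<notin> I \<Longrightarrow> x $ l = 0"
proof -
  define B :: "'a vec set" where "B = unit_vec n ` I"
  have B: "B \<subseteq> set (unit_vecs n)"
    using I by (auto simp: B_def unit_vecs_def)
  have carr: "B \<subseteq> carrier_vec n"
    by (auto simp: B_def)
  have "lin_indpt (set (unit_vecs n))"
    using unit_vecs_basis by (simp add: basis_def)
  then have indpt: "lin_indpt B"
    using B subset_li_is_li by blast
  have fin: "finite I"
    using I finite_subset by blast
  have "inj_on (unit_vec n :: nat \<Rightarrow> 'a vec) I"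
    using I by (auto intro!: inj_onI simp: unit_vec_eq)
  then have "card B = card I"
    by (simp add: B_def card_image)
  then have dim: "subspace_of_dim n (card I) (span B)"
    using dim_span_lin_indpt[OF _ carr indpt] fin span_is_subspace[of B] carr by (simp add: B_def)
  define T where "T = {x \<in> carrier_vec n. \<forall>l<n. l \<notin> I \<longrightarrow> x $ l = (0 :: 'a)}"
  have T: "subspace class_ring T V"
    by (rule subspaceI) (auto simp: T_def)
  have "span B \<subseteq> T"
    by (rule span_is_subset[OF _ is_module[OF T]]) (use I in \<open>auto simp: B_def T_def\<close>)
  then show ?thesis
    using that[OF dim] by (auto simp: T_def)
qed

end

section \<open>Hermitian and bilinear inner products\<close>

text \<open>
  The bilinear product is the case that \<open>\<sigma>\<close> is the identity, the complex one the case that it is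
  \<open>cnj\<close>.  That \<open>\<sigma>\<close> is an involutive automorphism makes orthogonality symmetric: the condition on
  an edge is linear in the vector at either end, once the vector at the other end is fixed.
\<close>
locale hermitian_product =
  fixes \<sigma> :: "'a :: field \<Rightarrow> 'a" and ip :: "'a vec \<Rightarrow> 'a vec \<Rightarrow> 'a"
  assumes conj_add: "\<sigma> (a + b) = \<sigma> a + \<sigma> b"
    and conj_mult: "\<sigma> (a * b) = \<sigma> a * \<sigma> b"
    and conj_conj: "\<sigma> (\<sigma> a) = a"
    and ip_eq: "x \<in> carrier_vec t \<Longrightarrow> y \<in> carrier_vec t \<Longrightarrow> ip x y = (\<Sum>l<t. x $ l * \<sigma> (y $ l))"
begin

lemma conj_0 [simp]: "\<sigma> 0 = 0"
  using conj_add[of 0 0] by (metis add_cancel_right_left add.right_neutral)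

lemma conj_eq_0_iff [simp]: "\<sigma> a = 0 \<longleftrightarrow> a = 0"
  by (metis conj_0 conj_conj)

lemma ip_add:
  assumes "x \<in> carrier_vec t" "y \<in> carrier_vec t" "z \<in> carrier_vec t"
  shows "ip (x + y) z = ip x z + ip y z"
proof -
  have "ip (x + y) z = (\<Sum>l<t. (x + y) $ l * \<sigma> (z $ l))"
    using assms by (intro ip_eq) auto
  also have "\<dots> = ip x z + ip y z"
    using assms by (simp add: ip_eq[of _ t] ring_distribs sum.distrib)
  finally show ?thesis .
qed

lemma ip_smult:
  assumes "x \<in> carrier_vec t" "z \<in> carrier_vec t"
  shows "ip (c \<cdot>\<^sub>v x) z = c * ip x z"
proof -
  have "ip (c \<cdot>\<^sub>v x) z = (\<Sum>l<t. (c \<cdot>\<^sub>v x) $ l * \<sigma> (z $ l))"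
    using assms by (intro ip_eq) auto
  also have "\<dots> = c * ip x z"
    using assms by (simp add: ip_eq[of _ t] sum_distrib_left mult.assoc)
  finally show ?thesis .
qed

lemma ip_eq_0_commute:
  assumes "x \<in> carrier_vec t" "y \<in> carrier_vec t"
  shows "ip x y = 0 \<longleftrightarrow> ip y x = 0"
proof -
  have conj_sum: "\<sigma> (\<Sum>l<s. f l) = (\<Sum>l<s. \<sigma> (f l))" for f and s :: nat
    by (induction s) (simp_all add: conj_add)
  have "ip y x = \<sigma> (ip x y)"
    using assms by (simp add: ip_eq[of _ t] conj_sum conj_mult conj_conj mult.commute)
  then show ?thesis
    by simp
qed

lemma orthogonal_subspace:
  assumes S: "subspace class_ring S (module_vec TYPE('a) t)" and Z: "Z \<subseteq> carrier_vec t"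
  shows "subspace class_ring {u \<in> S. \<forall>z\<in>Z. ip u z = 0} (module_vec TYPE('a) t)"
proof -
  interpret V: vec_space "TYPE('a)" t .
  note closed = V.subspace_closed[OF S]
  have zero: "ip (0\<^sub>v t) z = 0" if "z \<in> Z" for z
    using that Z by (subst ip_eq[of _ t]) auto
  have add: "ip (u + v) z = ip u z + ip v z" if "u \<in> S" "v \<in> S" "z \<in> Z" for u v z
    using that closed(1) Z by (intro ip_add[of _ t]) auto
  have smult: "ip (c \<cdot>\<^sub>v u) z = c * ip u z" if "u \<in> S" "z \<in> Z" for c u z
    using that closed(1) Z by (intro ip_smult[of _ t]) auto
  show ?thesis
    using closed zero add smult by (intro V.subspaceI) auto
qed

text \<open>
  The dimension count behind every step: orthogonality to the vectors of \<open>Z\<close> costs at most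
  \<open>card Z\<close> dimensions.  The exact size \<open>d\<close> matters to the applications, which turn the vectors
  of \<open>C\<close> into conditions on another vector and must not have too many of them.
\<close>
lemma independent_in_orthogonal:
  assumes S: "subspace class_ring S (module_vec TYPE('a) t)"
    and B: "finite B" "B \<subseteq> S" "independent t B"
    and Z: "finite Z" "Z \<subseteq> carrier_vec t"
    and d: "d + card Z \<le> card B"
  obtains C where "finite C" "C \<subseteq> {u \<in> S. \<forall>z\<in>Z. ip u z = 0}" "independent t C" "card C = d"
proof -
  interpret V: vec_space "TYPE('a)" t .
  have "\<exists>C. finite C \<and> C \<subseteq> {u \<in> S. \<forall>z\<in>Z. ip u z = 0} \<and> V.lin_indpt C
      \<and> card B \<le> card C + card Z"
    using Z
  proof (induction Z rule: finite_induct)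
    case empty
    then show ?case
      using B by auto
  next
    case (insert z Z)
    then obtain C where C: "finite C" "C \<subseteq> {u \<in> S. \<forall>z\<in>Z. ip u z = 0}" "V.lin_indpt C"
      "card B \<le> card C + card Z"
      by auto
    have S': "subspace class_ring {u \<in> S. \<forall>z\<in>Z. ip u z = 0} V.V"
      using orthogonal_subspace[OF S] insert.prems by simp
    have carr: "u \<in> carrier_vec t" if "u \<in> {u \<in> S. \<forall>z\<in>Z. ip u z = 0}" for u
      using that V.subspace_closed(1)[OF S] by blast
    have z: "z \<in> carrier_vec t"
      using insert.prems by simp
    obtain C' where C': "finite C'" "C' \<subseteq> {u \<in> {u \<in> S. \<forall>z\<in>Z. ip u z = 0}. ip u z = 0}"
      "V.lin_indpt C'" "card C \<le> card C' + 1"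
      by (rule V.lin_indpt_in_kernel[OF S' C(1,2,3), of "\<lambda>u. ip u z"])
        (use carr z ip_add[of _ t] ip_smult[of _ t] in auto)
    have "C' \<subseteq> {u \<in> S. \<forall>z\<in>insert z Z. ip u z = 0}"
      using C'(2) by auto
    moreover have "card B \<le> card C' + card (insert z Z)"
      using C(4) C'(4) insert.hyps by simp
    ultimately show ?case
      using C'(1,3) by blast
  qed
  then obtain C where C: "finite C" "C \<subseteq> {u \<in> S. \<forall>z\<in>Z. ip u z = 0}" "V.lin_indpt C"
      "card B \<le> card C + card Z"
    by blast
  then have "d \<le> card C"
    using d by linarith
  then obtain D where D: "D \<subseteq> C" "card D = d"
    using obtain_subset_with_card_n[of d C] by auto
  then have "V.lin_indpt D"
    using C(3) V.subset_li_is_li by blast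
  then show ?thesis
    using that[of D] C(1,2) D finite_subset by blast
qed

lemma nonzero_orthogonal:
  assumes S: "subspace class_ring S (module_vec TYPE('a) t)"
    and B: "finite B" "B \<subseteq> S" "independent t B"
    and Z: "finite Z" "Z \<subseteq> carrier_vec t"
    and less: "card Z < card B"
  obtains u where "u \<in> S" "u \<noteq> 0\<^sub>v t" "\<forall>z\<in>Z. ip u z = 0"
proof -
  interpret V: vec_space "TYPE('a)" t .
  obtain C where C: "finite C" "C \<subseteq> {u \<in> S. \<forall>z\<in>Z. ip u z = 0}" "V.lin_indpt C" "card C = 1"
    using independent_in_orthogonal[OF S B Z, of 1] less by auto
  then obtain u where u: "C = {u}"
    by (auto simp: card_1_singleton_iff)
  then have "u \<noteq> 0\<^sub>v t"
    using V.vs_zero_lin_dep[of C] C(2,3) V.subspace_closed(1)[OF S] by auto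
  then show ?thesis
    using that[of u] C(2) u by auto
qed

lemma subspace_of_dim_basis:
  assumes "subspace_of_dim t d W"
  obtains B where "finite B" "B \<subseteq> W" "independent t B" "card B = d"
  using vec_space.subspace_basis[of W t] assms by auto

section \<open>Choosability of complete bipartite graphs\<close>

text \<open>
  Every edge is a pair of opposite arcs; as orthogonality is symmetric, one of the two conditions is
  enough.
\<close>
lemma subspace_choosable_complete_bipartite_iff:
  "subspace_choosable ip (complete_bipartite k m) d \<longleftrightarrow>
    (\<forall>t W U. (\<forall>i<k. subspace_of_dim t d (W i)) \<and> (\<forall>j<m. subspace_of_dim t d (U j)) \<longrightarrow>
      (\<exists>x y. (\<forall>i<k. x i \<in> W i \<and> x i \<noteq> 0\<^sub>v t) \<and> (\<forall>j<m. y j \<in> U j \<and> y j \<noteq> 0\<^sub>v t) \<and>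
        (\<forall>i<k. \<forall>j<m. ip (y j) (x i) = 0)))" (is "_ \<longleftrightarrow> ?R")
proof
  assume choosable: "subspace_choosable ip (complete_bipartite k m) d"
  show ?R
  proof (intro allI impI, elim conjE)
    fix t and W U :: "nat \<Rightarrow> 'a vec set"
    assume W: "\<forall>i<k. subspace_of_dim t d (W i)" and U: "\<forall>j<m. subspace_of_dim t d (U j)"
    have "\<forall>v\<in>pverts (complete_bipartite k m). subspace_of_dim t d (case_sum W U v)"
      using W U by (auto simp: complete_bipartite_def)
    from choosable[unfolded subspace_choosable_def, THEN spec, THEN spec, THEN mp, OF this]
    obtain x where
      x: "\<forall>v\<in>pverts (complete_bipartite k m). x v \<in> case_sum W U v \<and> x v \<noteq> 0\<^sub>v t"
        "\<forall>(v, w)\<in>parcs (complete_bipartite k m). ip (x v) (x w) = 0"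
      by blast
    show "\<exists>x y. (\<forall>i<k. x i \<in> W i \<and> x i \<noteq> 0\<^sub>v t) \<and> (\<forall>j<m. y j \<in> U j \<and> y j \<noteq> 0\<^sub>v t) \<and>
        (\<forall>i<k. \<forall>j<m. ip (y j) (x i) = 0)"
    proof (intro exI conjI allI impI)
      show "(x \<circ> Inl) i \<in> W i" "(x \<circ> Inl) i \<noteq> 0\<^sub>v t" if "i < k" for i
        using x(1)[THEN bspec, of "Inl i"] that by (auto simp: complete_bipartite_def)
      show "(x \<circ> Inr) j \<in> U j" "(x \<circ> Inr) j \<noteq> 0\<^sub>v t" if "j < m" for j
        using x(1)[THEN bspec, of "Inr j"] that by (auto simp: complete_bipartite_def)
      show "ip ((x \<circ> Inr) j) ((x \<circ> Inl) i) = 0" if "i < k" "j < m" for i j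
      proof -
        have "(Inr j, Inl i) \<in> parcs (complete_bipartite k m)"
          using that by (simp add: complete_bipartite_def)
        then show ?thesis
          using x(2) by fastforce
      qed
    qed
  qed
next
  assume R: ?R
  show "subspace_choosable ip (complete_bipartite k m) d"
    unfolding subspace_choosable_def
  proof (intro allI impI)
    fix t and W :: "nat + nat \<Rightarrow> 'a vec set"
    assume W: "\<forall>v\<in>pverts (complete_bipartite k m). subspace_of_dim t d (W v)"
    have "(\<forall>i<k. subspace_of_dim t d ((W \<circ> Inl) i)) \<and> (\<forall>j<m. subspace_of_dim t d ((W \<circ> Inr) j))"
      using W by (auto simp: complete_bipartite_def)
    from R[THEN spec, THEN spec, THEN spec, THEN mp, OF this]
    obtain x y where
      x: "\<forall>i<k. x i \<in> W (Inl i) \<and> x i \<noteq> 0\<^sub>v t" and y: "\<forall>j<m. y j \<in> W (Inr j) \<and> y j \<noteq> 0\<^sub>v t" and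
      orth: "\<forall>i<k. \<forall>j<m. ip (y j) (x i) = 0"
      by auto
    have carr: "W v \<subseteq> carrier_vec t" if "v \<in> pverts (complete_bipartite k m)" for v
      using vec_space.subspace_closed(1)[of "W v"] that W by blast
    have "ip (x i) (y j) = 0" if ij: "i < k" "j < m" for i j
    proof -
      have "x i \<in> carrier_vec t" "y j \<in> carrier_vec t"
        using ij x y carr[of "Inl i"] carr[of "Inr j"] by (auto simp: complete_bipartite_def)
      then show ?thesis
        using orth ij ip_eq_0_commute by blast
    qed
    then show "\<exists>x. (\<forall>v\<in>pverts (complete_bipartite k m). x v \<in> W v \<and> x v \<noteq> 0\<^sub>v t) \<and>
        (\<forall>(v, w)\<in>parcs (complete_bipartite k m). ip (x v) (x w) = 0)"
      using x y orth
      by (intro exI[of _ "case_sum x y"]) (auto simp: complete_bipartite_def)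
  qed
qed

text \<open>
  Shrink all spaces to dimension \<open>d\<close>.  Hence to see that the choice number exceeds \<open>k\<close>, it is enough
  to refute \<open>k\<close>-choosability.
\<close>
lemma subspace_choosable_mono:
  fixes G :: "'v pair_pre_digraph"
  assumes choosable: "subspace_choosable ip G d" and "d \<le> e"
  shows "subspace_choosable ip G e"
  unfolding subspace_choosable_def
proof (intro allI impI)
  fix t and W :: "'v \<Rightarrow> 'a vec set"
  assume W: "\<forall>v\<in>pverts G. subspace_of_dim t e (W v)"
  interpret V: vec_space "TYPE('a)" t .
  have "\<exists>U. subspace_of_dim t d U \<and> U \<subseteq> W v" if v: "v \<in> pverts G" for v
  proof -
    obtain B where B: "finite B" "B \<subseteq> W v" "V.lin_indpt B" "card B = e"
      by (rule subspace_of_dim_basis[OF bspec[OF W v]])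
    then obtain C where C: "C \<subseteq> B" "card C = d"
      using \<open>d \<le> e\<close> obtain_subset_with_card_n[of d B] by auto
    have "subspace class_ring (W v) V.V"
      using bspec[OF W v] ..
    then have WV: "submodule class_ring (W v) V.V" "W v \<subseteq> carrier_vec t"
      using V.subspace_closed(1) V.is_module by simp_all
    have "C \<subseteq> W v" "finite C" "V.lin_indpt C"
      using B C(1) finite_subset V.subset_li_is_li[OF B(3) C(1)] by auto
    moreover from this have "C \<subseteq> carrier_vec t"
      using WV(2) by simp
    ultimately show ?thesis
      using V.dim_span_lin_indpt[of C] C(2) V.span_is_subspace[of C] V.span_is_subset[OF _ WV(1), of C]
      by (intro exI[of _ "V.span C"]) auto
  qed
  then obtain U where U: "\<forall>v\<in>pverts G. subspace_of_dim t d (U v) \<and> U v \<subseteq> W v"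
    by metis
  then have "\<forall>v\<in>pverts G. subspace_of_dim t d (U v)"
    by blast
  from choosable[unfolded subspace_choosable_def, THEN spec, THEN spec, THEN mp, OF this]
  obtain x where "\<forall>v\<in>pverts G. x v \<in> U v \<and> x v \<noteq> 0\<^sub>v t"
      "\<forall>(v, w)\<in>parcs G. ip (x v) (x w) = 0"
    by blast
  then show "\<exists>x. (\<forall>v\<in>pverts G. x v \<in> W v \<and> x v \<noteq> 0\<^sub>v t) \<and> (\<forall>(v, w)\<in>parcs G. ip (x v) (x w) = 0)"
    using U by blast
qed

text \<open>
  Arbitrary nonzero vectors on the left leave \<open>k\<close> conditions on each right space of dimension \<open>k + 1\<close>.
\<close>
lemma complete_bipartite_choosable_Suc:
  "subspace_choosable ip (complete_bipartite k m) (k + 1)"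
  unfolding subspace_choosable_complete_bipartite_iff
proof (intro allI impI, elim conjE)
  fix t and W U :: "nat \<Rightarrow> 'a vec set"
  assume W: "\<forall>i<k. subspace_of_dim t (k + 1) (W i)" and U: "\<forall>j<m. subspace_of_dim t (k + 1) (U j)"
  interpret V: vec_space "TYPE('a)" t .
  have "\<exists>x. x \<in> W i \<and> x \<noteq> 0\<^sub>v t" if i: "i < k" for i
  proof -
    obtain B where B: "finite B" "B \<subseteq> W i" "V.lin_indpt B" "card B = k + 1"
      by (rule subspace_of_dim_basis[OF W[rule_format, OF i]])
    obtain u where "u \<in> W i" "u \<noteq> 0\<^sub>v t"
      by (rule nonzero_orthogonal[OF _ B(1-3), of "{}"]) (use W i B(4) in auto)
    then show ?thesis
      by blast
  qed
  then obtain x where x: "\<forall>i<k. x i \<in> W i \<and> x i \<noteq> 0\<^sub>v t"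
    by metis
  have "\<exists>y. y \<in> U j \<and> y \<noteq> 0\<^sub>v t \<and> (\<forall>i<k. ip y (x i) = 0)" if j: "j < m" for j
  proof -
    obtain B where B: "finite B" "B \<subseteq> U j" "V.lin_indpt B" "card B = k + 1"
      by (rule subspace_of_dim_basis[OF U[rule_format, OF j]])
    have "x ` {..<k} \<subseteq> carrier_vec t"
      using x W V.subspace_closed(1) by blast
    moreover have "card (x ` {..<k}) < card B"
      using card_image_le[of "{..<k}" x] B(4) by simp
    ultimately obtain u where "u \<in> U j" "u \<noteq> 0\<^sub>v t" "\<forall>z\<in>x ` {..<k}. ip u z = 0"
      by (rule nonzero_orthogonal[OF _ B(1-3), rotated 2]) (use U j in auto)
    then show ?thesis
      by blast
  qed
  then obtain y where "\<forall>j<m. y j \<in> U j \<and> y j \<noteq> 0\<^sub>v t \<and> (\<forall>i<k. ip (y j) (x i) = 0)"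
    by metis
  then show "\<exists>x y. (\<forall>i<k. x i \<in> W i \<and> x i \<noteq> 0\<^sub>v t) \<and> (\<forall>j<m. y j \<in> U j \<and> y j \<noteq> 0\<^sub>v t) \<and>
      (\<forall>i<k. \<forall>j<m. ip (y j) (x i) = 0)"
    using x by blast
qed

section \<open>Choosing the left vectors in stages\<close>

text \<open>
  The right vertex \<open>j\<close> is served by the left vertex \<open>k - s j\<close>: before its vector is chosen, at least
  \<open>s j\<close> dimensions of \<open>U j\<close> are orthogonal to the earlier vectors, and exactly \<open>s j\<close> of them are
  reserved by making the new vector orthogonal to them as well.  Afterwards only \<open>s j - 1\<close> left
  vectors remain to be chosen, whatever they are, so a nonzero reserved vector orthogonal to all of
  them survives.  The assumption on the fibres of \<open>s\<close> says that each left vertex has to satisfy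
  fewer than \<open>k\<close> conditions.
\<close>
lemma choosable_of_schedule:
  assumes s: "\<forall>j<m. 1 \<le> s j \<and> s j \<le> k"
    and load: "\<forall>i. 1 \<le> i \<and> i \<le> k \<longrightarrow> card {j. j < m \<and> s j = i} * i < k"
  shows "subspace_choosable ip (complete_bipartite k m) k"
  unfolding subspace_choosable_complete_bipartite_iff
proof (intro allI impI, elim conjE)
  fix t and W U :: "nat \<Rightarrow> 'a vec set"
  assume W: "\<forall>i<k. subspace_of_dim t k (W i)" and U: "\<forall>j<m. subspace_of_dim t k (U j)"
  interpret V: vec_space "TYPE('a)" t .
  have sub_W: "subspace class_ring (W i) V.V" if "i < k" for i
    using W[rule_format, OF that] ..
  have sub_U: "subspace class_ring (U j) V.V" if "j < m" for j
    using U[rule_format, OF that] ..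
  have carr_W: "x \<in> carrier_vec t" if "x \<in> W i" "i < k" for x i
    using V.subspace_closed(1)[OF sub_W] that by blast
  have carr_U: "y \<in> carrier_vec t" if "y \<in> U j" "j < m" for y j
    using V.subspace_closed(1)[OF sub_U] that by blast
  \<comment> \<open>\<open>C\<close> reserves \<open>s j\<close> dimensions of \<open>U j\<close> that the first \<open>n\<close> left vectors respect.\<close>
  define reserved where "reserved n x j C \<longleftrightarrow> finite C \<and> V.lin_indpt C \<and> card C = s j \<and>
      C \<subseteq> {u \<in> U j. \<forall>z\<in>x ` {..<n}. ip u z = 0}" for n and x :: "nat \<Rightarrow> 'a vec" and j C
  have stages: "\<exists>x. (\<forall>i<n. x i \<in> W i \<and> x i \<noteq> 0\<^sub>v t) \<and>
      (\<forall>j<m. k < s j + n \<longrightarrow> (\<exists>C. reserved (k - s j + 1) x j C))" if "n \<le> k" for n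
    using that
  proof (induction n)
    case 0
    have "\<not> k < s j + 0" if "j < m" for j
      using s that by (simp add: not_less)
    then show ?case
      by blast
  next
    case (Suc n)
    then obtain x where x: "\<forall>i<n. x i \<in> W i \<and> x i \<noteq> 0\<^sub>v t"
      and old: "\<forall>j<m. k < s j + n \<longrightarrow> (\<exists>C. reserved (k - s j + 1) x j C)"
      by auto
    \<comment> \<open>The right vertices that the left vertex \<open>n\<close> serves.\<close>
    define J where "J = {j. j < m \<and> s j = k - n}"
    have carr_x: "x ` {..<n} \<subseteq> carrier_vec t"
      using x carr_W Suc.prems by auto
    have "\<exists>C. reserved n x j C" if "j \<in> J" for j
    proof -
      have j: "j < m" "s j = k - n"
        using that by (auto simp: J_def)
      obtain B where B: "finite B" "B \<subseteq> U j" "V.lin_indpt B" "card B = k"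
        by (rule subspace_of_dim_basis[OF U[rule_format, OF j(1)]])
      have "s j + card (x ` {..<n}) \<le> card B"
        using card_image_le[of "{..<n}" x] Suc.prems B(4) j(2) by simp
      then obtain C where "finite C" "C \<subseteq> {u \<in> U j. \<forall>z\<in>x ` {..<n}. ip u z = 0}" "V.lin_indpt C"
        "card C = s j"
        by (rule independent_in_orthogonal[OF sub_U[OF j(1)] B(1-3) _ carr_x, rotated]) auto
      then show ?thesis
        by (auto simp: reserved_def)
    qed
    then obtain C where C: "\<forall>j\<in>J. reserved n x j (C j)"
      by metis
    \<comment> \<open>The conditions that these impose on the vector of the left vertex \<open>n\<close>.\<close>
    define Z where "Z = (\<Union>j\<in>J. C j)"
    have "finite J"
      by (simp add: J_def)
    have "card Z \<le> (\<Sum>j\<in>J. card (C j))"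
      unfolding Z_def using \<open>finite J\<close> by (rule card_UN_le)
    also have "\<dots> = (\<Sum>j\<in>J. k - n)"
      using C by (intro sum.cong) (auto simp: reserved_def J_def)
    also have "\<dots> = card J * (k - n)"
      by simp
    also have "\<dots> < k"
      using load Suc.prems by (simp add: J_def)
    finally have "card Z < k" .
    obtain B where B: "finite B" "B \<subseteq> W n" "V.lin_indpt B" "card B = k"
      using Suc.prems by (elim subspace_of_dim_basis[OF W[rule_format, of n], rotated]) auto
    have CU: "C j \<subseteq> U j" if "j \<in> J" for j
      using C that by (auto simp: reserved_def)
    have "finite Z"
      using C \<open>finite J\<close> by (auto simp: Z_def reserved_def)
    moreover have "Z \<subseteq> carrier_vec t"
      using CU carr_U by (fastforce simp: Z_def J_def)
    ultimately obtain w where w: "w \<in> W n" "w \<noteq> 0\<^sub>v t" "\<forall>z\<in>Z. ip w z = 0"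
      by (rule nonzero_orthogonal[OF sub_W B(1-3), rotated 1])
        (use Suc.prems B(4) \<open>card Z < k\<close> in auto)
    define x' where "x' = x(n := w)"
    have "\<exists>C. reserved (k - s j + 1) x' j C" if j: "j < m" "k < s j + Suc n" for j
    proof (cases "j \<in> J")
      case True
      have sj: "k - s j + 1 = Suc n"
        using True Suc.prems by (simp add: J_def)
      have "ip u w = 0" if "u \<in> C j" for u
      proof -
        have "u \<in> carrier_vec t" "w \<in> carrier_vec t" "u \<in> Z"
          using that True CU carr_U j(1) carr_W w(1) Suc.prems by (auto simp: Z_def)
        then show ?thesis
          using w(3) ip_eq_0_commute by blast
      qed
      moreover have "x' ` {..<Suc n} = insert w (x ` {..<n})"
        by (auto simp: x'_def lessThan_Suc)
      moreover have "reserved n x j (C j)"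
        using C True by blast
      ultimately have "reserved (k - s j + 1) x' j (C j)"
        unfolding sj by (auto simp: reserved_def)
      then show ?thesis ..
    next
      case False
      then have "k < s j + n"
        using j s Suc.prems by (auto simp: J_def)
      moreover from this have "x' ` {..<k - s j + 1} = x ` {..<k - s j + 1}"
        using s j(1) by (intro image_cong) (auto simp: x'_def)
      ultimately show ?thesis
        using old j(1) by (simp add: reserved_def)
    qed
    moreover have "\<forall>i<Suc n. x' i \<in> W i \<and> x' i \<noteq> 0\<^sub>v t"
      using x w by (auto simp: x'_def less_Suc_eq)
    ultimately show ?case
      by blast
  qed
  obtain x where x: "\<forall>i<k. x i \<in> W i \<and> x i \<noteq> 0\<^sub>v t"
    and res: "\<forall>j<m. k < s j + k \<longrightarrow> (\<exists>C. reserved (k - s j + 1) x j C)"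
    using stages[of k] by auto
  have "\<exists>y. y \<in> U j \<and> y \<noteq> 0\<^sub>v t \<and> (\<forall>i<k. ip y (x i) = 0)" if j: "j < m" for j
  proof -
    have sj: "1 \<le> s j" "s j \<le> k"
      using s j by auto
    \<comment> \<open>The reserved dimensions pay only for the left vectors chosen after the serving one.\<close>
    define early late where "early = x ` {..<k - s j + 1}" and "late = x ` {k - s j + 1..<k}"
    obtain C where C: "finite C" "V.lin_indpt C" "card C = s j"
      "C \<subseteq> {u \<in> U j. \<forall>z\<in>early. ip u z = 0}"
      using res j sj by (auto simp: reserved_def early_def)
    have "x i \<in> carrier_vec t" if "i < k" for i
      using x carr_W that by blast
    then have carr: "early \<subseteq> carrier_vec t" "late \<subseteq> carrier_vec t"
      using sj by (auto simp: early_def late_def)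
    have "card late < card C"
      using card_image_le[of "{k - s j + 1..<k}" x] sj C(3) by (simp add: late_def)
    then obtain u where u: "u \<in> {u \<in> U j. \<forall>z\<in>early. ip u z = 0}" "u \<noteq> 0\<^sub>v t" "\<forall>z\<in>late. ip u z = 0"
      by (rule nonzero_orthogonal[OF orthogonal_subspace[OF sub_U[OF j] carr(1)] C(1,4,2) _ carr(2), rotated])
        (auto simp: late_def)
    have "ip u (x i) = 0" if "i < k" for i
    proof (cases "i < k - s j + 1")
      case True
      then show ?thesis
        using u(1) by (auto simp: early_def)
    next
      case False
      then show ?thesis
        using u(3) that by (auto simp: late_def)
    qed
    then show ?thesis
      using u by blast
  qed
  then obtain y where "\<forall>j<m. y j \<in> U j \<and> y j \<noteq> 0\<^sub>v t \<and> (\<forall>i<k. ip (y j) (x i) = 0)"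
    by metis
  then show "\<exists>x y. (\<forall>i<k. x i \<in> W i \<and> x i \<noteq> 0\<^sub>v t) \<and> (\<forall>j<m. y j \<in> U j \<and> y j \<noteq> 0\<^sub>v t) \<and>
      (\<forall>i<k. \<forall>j<m. ip (y j) (x i) = 0)"
    using x by blast
qed

end

text \<open>
  If bins have enough capacity in total, then \<open>m\<close> objects can be distributed over them: inject the
  objects into the disjoint union of the bins.
\<close>
lemma exists_bounded_fibres:
  fixes c :: "nat \<Rightarrow> nat"
  assumes I: "finite I" and m: "m \<le> (\<Sum>i\<in>I. c i)"
  obtains s where "\<forall>j<m. s j \<in> I" "\<forall>i\<in>I. card {j. j < m \<and> s j = i} \<le> c i"
proof -
  define P where "P = (SIGMA i:I. {..<c i})"
  have "card {..<m} \<le> card P" "finite P"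
    using I m by (auto simp: P_def card_SigmaI)
  then obtain h where h: "h ` {..<m} \<subseteq> P" "inj_on h {..<m}"
    using card_le_inj[of "{..<m}" P] by auto
  have "card {j. j < m \<and> fst (h j) = i} \<le> c i" if "i \<in> I" for i
  proof -
    have "inj_on h {j. j < m \<and> fst (h j) = i}"
      using h(2) by (auto simp: inj_on_def)
    moreover have "h ` {j. j < m \<and> fst (h j) = i} \<subseteq> {i} \<times> {..<c i}"
      using h(1) by (fastforce simp: P_def)
    ultimately have "card {j. j < m \<and> fst (h j) = i} \<le> card ({i} \<times> {..<c i})"
      by (rule card_inj_on_le) simp
    then show ?thesis
      by simp
  qed
  moreover have "\<forall>j<m. fst (h j) \<in> I"
    using h(1) by (fastforce simp: P_def)
  ultimately show ?thesis
    using that[of "fst \<circ> h"] by simp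
qed

section \<open>A complete bipartite graph of choice number \<open>k + 1\<close>\<close>

context hermitian_product
begin

text \<open>
  A nonzero vector in the span of the \<open>i\<close>-th block of unit vectors has a nonzero coordinate at some
  position \<open>f i\<close> of that block.  The right vertex belonging to the transversal \<open>f\<close> then has no
  admissible vector.  Indeed, such a vector would have a nonzero coordinate at the position \<open>f i\<close> of
  some block \<open>i\<close>.  As the transversal meets block \<open>i\<close> only there, the product with the vector chosen
  for block \<open>i\<close> is a sum with a single nonzero term.
\<close>
lemma not_choosable_blocks:
  assumes "k \<ge> 1"
  shows "\<not> subspace_choosable ip (complete_bipartite k (k ^ k)) k"
proof
  assume choosable: "subspace_choosable ip (complete_bipartite k (k ^ k)) k"
  define t where "t = k * k"
  interpret V: vec_space "TYPE('a)" t .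
  have pos: "i * k + a < t" if "i < k" "a < k" for i a
  proof -
    have "i * k + a < Suc i * k"
      using that by simp
    also have "\<dots> \<le> t"
      using that unfolding t_def by (intro mult_right_mono) auto
    finally show ?thesis .
  qed
  have eqD: "i = i' \<and> a = a'" if "i * k + a = i' * k + a'" "a < k" "a' < k" for i i' a a'
    using arg_cong[OF that(1), of "\<lambda>q. q div k"] arg_cong[OF that(1), of "\<lambda>q. q mod k"] that(2,3)
    by simp
  define block where "block i = (\<lambda>a. i * k + a) ` {..<k}" for i
  have card_block: "card (block i) = k" for i
    by (simp add: block_def card_image)
  define supported where "supported I S \<longleftrightarrow>
      subspace_of_dim t k S \<and> (\<forall>x\<in>S. \<forall>l<t. l \<notin> I \<longrightarrow> x $ l = 0)" for I and S :: "'a vec set"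
  have supported_exists: "\<exists>S. supported I S" if "I \<subseteq> {..<t}" "card I = k" for I
    using V.coordinate_subspace[OF that(1)] that(2) unfolding supported_def by metis
  have "\<exists>W. supported (block i) W" if "i < k" for i
  proof -
    have "block i \<subseteq> {..<t}"
      using pos that by (auto simp: block_def)
    then show ?thesis
      using supported_exists card_block by blast
  qed
  then obtain W where "\<forall>i<k. supported (block i) (W i)"
    by metis
  then have W: "\<forall>i<k. subspace_of_dim t k (W i) \<and> (\<forall>x\<in>W i. \<forall>l<t. l \<notin> block i \<longrightarrow> x $ l = 0)"
    by (simp add: supported_def)
  define F where "F = ({..<k} \<rightarrow>\<^sub>E {..<k})"
  have F: "finite F" "card F = k ^ k"
    by (simp_all add: F_def finite_PiE card_PiE)
  obtain h where h: "bij_betw h {..<k ^ k} F"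
    using ex_bij_betw_nat_finite[OF F(1)] F(2) by (auto simp: lessThan_atLeast0)
  define trans where "trans f = (\<lambda>i. i * k + f i) ` {..<k}" for f
  have "\<exists>U. supported (trans (h j)) U" if "j < k ^ k" for j
  proof -
    have hj: "h j i < k" if "i < k" for i
      using bij_betwE[OF h] \<open>j < k ^ k\<close> that by (auto simp: F_def PiE_def Pi_def)
    then have "inj_on (\<lambda>i. i * k + h j i) {..<k}"
      using eqD by (intro inj_onI) blast
    then have "card (trans (h j)) = k"
      by (simp add: trans_def card_image)
    moreover have "trans (h j) \<subseteq> {..<t}"
      using hj pos by (auto simp: trans_def)
    ultimately show ?thesis
      using supported_exists by blast
  qed
  then obtain U where "\<forall>j<k ^ k. supported (trans (h j)) (U j)"
    by metis
  then have U: "\<forall>j<k ^ k. subspace_of_dim t k (U j) \<and>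
      (\<forall>x\<in>U j. \<forall>l<t. l \<notin> trans (h j) \<longrightarrow> x $ l = 0)"
    by (simp add: supported_def)
  have "(\<forall>i<k. subspace_of_dim t k (W i)) \<and> (\<forall>j<k ^ k. subspace_of_dim t k (U j))"
    using W U by blast
  from choosable[unfolded subspace_choosable_complete_bipartite_iff, THEN spec, THEN spec, THEN spec,
      THEN mp, OF this]
  obtain x y where x: "\<forall>i<k. x i \<in> W i \<and> x i \<noteq> 0\<^sub>v t" and y: "\<forall>j<k ^ k. y j \<in> U j \<and> y j \<noteq> 0\<^sub>v t"
    and orth: "\<forall>i<k. \<forall>j<k ^ k. ip (y j) (x i) = 0"
    by blast
  have carr_x: "x i \<in> carrier_vec t" if "i < k" for i
    using V.subspace_closed(1)[of "W i"] W x that by blast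
  have carr_y: "y j \<in> carrier_vec t" if "j < k ^ k" for j
    using V.subspace_closed(1)[of "U j"] U y that by blast
  have block_x: "l \<in> block i" if "i < k" "l < t" "x i $ l \<noteq> 0" for i l
  proof -
    have "\<forall>v\<in>W i. \<forall>l<t. l \<notin> block i \<longrightarrow> v $ l = 0" "x i \<in> W i"
      using W x that(1) by blast+
    then show ?thesis
      using that(2,3) by blast
  qed
  have trans_y: "l \<in> trans (h j)" if "j < k ^ k" "l < t" "y j $ l \<noteq> 0" for j l
  proof -
    have "\<forall>v\<in>U j. \<forall>l<t. l \<notin> trans (h j) \<longrightarrow> v $ l = 0" "y j \<in> U j"
      using U y that(1) by blast+
    then show ?thesis
      using that(2,3) by blast
  qed
  have nonzero: "\<exists>l<t. v $ l \<noteq> 0" if "v \<in> carrier_vec t" "v \<noteq> 0\<^sub>v t" for v :: "'a vec"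
    using that by (auto simp: vec_eq_iff)
  have "\<exists>a<k. x i $ (i * k + a) \<noteq> 0" if i: "i < k" for i
  proof -
    obtain l where l: "l < t" "x i $ l \<noteq> 0"
      using nonzero[OF carr_x[OF i]] x i by blast
    then have "l \<in> block i"
      using block_x i by blast
    then show ?thesis
      using l(2) by (auto simp: block_def)
  qed
  then obtain f where f: "\<forall>i<k. f i < k \<and> x i $ (i * k + f i) \<noteq> 0"
    by metis
  have "restrict f {..<k} \<in> F"
    using f by (auto simp: F_def)
  then obtain j where j: "j < k ^ k" "h j = restrict f {..<k}"
    using h by (metis bij_betw_iff_bijections lessThan_iff)
  have trans_f: "trans (h j) = (\<lambda>i. i * k + f i) ` {..<k}"
    by (simp add: trans_def j(2))
  obtain l where l: "l < t" "y j $ l \<noteq> 0"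
    using nonzero[OF carr_y[OF j(1)]] y j(1) by blast
  then have "l \<in> trans (h j)"
    using trans_y j(1) by blast
  then obtain i where i: "i < k" "l = i * k + f i"
    by (auto simp: trans_f)
  have "y j $ q * \<sigma> (x i $ q) = 0" if q: "q < t" "q \<noteq> l" for q
  proof (rule ccontr)
    assume "y j $ q * \<sigma> (x i $ q) \<noteq> 0"
    then have "y j $ q \<noteq> 0" "x i $ q \<noteq> 0"
      by auto
    then have "q \<in> trans (h j)" "q \<in> block i"
      using trans_y[OF j(1) q(1)] block_x[OF i(1) q(1)] by blast+
    then obtain i' a where "i' < k" "q = i' * k + f i'" "a < k" "q = i * k + a"
      by (auto simp: trans_f block_def)
    then show False
      using eqD[of i' "f i'" i a] f i(2) q(2) by auto
  qed
  then have "(\<Sum>q<t. y j $ q * \<sigma> (x i $ q)) = (\<Sum>q\<in>{l}. y j $ q * \<sigma> (x i $ q))"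
    using l(1) by (intro sum.mono_neutral_right) auto
  then have "ip (y j) (x i) = y j $ l * \<sigma> (x i $ l)"
    using ip_eq[OF carr_y[OF j(1)] carr_x[OF i(1)]] by simp
  then show False
    using orth i j(1) l(2) f by auto
qed

lemma ch_s_attains_maximum:
  assumes "k \<ge> 1"
  shows "ch_s ip (complete_bipartite k (k ^ k)) = k + 1"
  unfolding ch_s_def
proof (rule Least_equality)
  show "1 \<le> k + 1 \<and> subspace_choosable ip (complete_bipartite k (k ^ k)) (k + 1)"
    using complete_bipartite_choosable_Suc by simp
  show "k + 1 \<le> d" if "1 \<le> d \<and> subspace_choosable ip (complete_bipartite k (k ^ k)) d" for d
    using that subspace_choosable_mono[of _ d k] not_choosable_blocks[OF assms] by force
qed

end

section \<open>The bound and its growth\<close>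

lemma ln_le_harmonic_sum:
  assumes "k \<ge> 1"
  shows "ln (real k) \<le> (\<Sum>i = 1..k - 1. 1 / real i)"
  using assms
proof (induction k rule: dec_induct)
  case base
  then show ?case by simp
next
  case (step k)
  have "real (Suc k) = real k * (1 + 1 / real k)"
    using step.hyps by (simp add: field_simps)
  then have "ln (real (Suc k)) = ln (real k) + ln (1 + 1 / real k)"
    using step.hyps by (simp add: ln_mult_pos add_pos_nonneg)
  also have "\<dots> \<le> (\<Sum>i = 1..k - 1. 1 / real i) + 1 / real k"
    using step by (intro add_mono ln_add_one_self_le_self) auto
  also have "\<dots> = (\<Sum>i = 1..Suc k - 1. 1 / real i)"
    using step.hyps by (cases k) auto
  finally show ?case .
qed

text \<open>
  Dropping the floors loses at most \<open>1\<close> per summand, so the sum is at least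
  \<open>(k - 1) * (ln k - 1)\<close>, and both factors are at least half of \<open>k\<close> and \<open>ln k\<close> as soon as
  \<open>ln k \<ge> 2\<close>; this gives the constant \<open>4\<close>.
\<close>
lemma harmonic_floor_sum_bigomega:
  fixes f :: "nat \<Rightarrow> nat"
  assumes "\<forall>k\<ge>1. int (f k) > (\<Sum>i = 1..k - 1. \<lfloor>(real k - 1) / real i\<rfloor>)"
  shows "(\<lambda>k. real (f k)) \<in> \<Omega>(\<lambda>k. real k * ln (real k))"
proof -
  have le: "(real k - 1) * (ln (real k) - 1) \<le> real (f k)" if k: "k \<ge> 1" for k
  proof -
    have "(real k - 1) * (ln (real k) - 1) \<le> (real k - 1) * ((\<Sum>i = 1..k - 1. 1 / real i) - 1)"
      using ln_le_harmonic_sum[OF k] k by (intro mult_left_mono) auto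
    also have "\<dots> = (\<Sum>i = 1..k - 1. (real k - 1) / real i - 1)"
      using k by (simp add: sum_subtractf sum_distrib_left of_nat_diff right_diff_distrib)
    also have "\<dots> \<le> (\<Sum>i = 1..k - 1. of_int \<lfloor>(real k - 1) / real i\<rfloor>)"
      by (intro sum_mono) linarith
    also have "\<dots> = of_int (\<Sum>i = 1..k - 1. \<lfloor>(real k - 1) / real i\<rfloor>)"
      by simp
    also have "\<dots> \<le> of_int (int (f k))"
      using assms k by (simp only: of_int_le_iff) (simp add: less_imp_le)
    finally show ?thesis
      by simp
  qed
  have "(\<lambda>k. real k * ln (real k)) \<in> O(\<lambda>k. real (f k))"
  proof (rule bigoI[where c = 4])
    have "filterlim (\<lambda>k. ln (real k)) at_top sequentially"
      using filterlim_compose[OF ln_at_top filterlim_real_sequentially] .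
    then have "eventually (\<lambda>k. 2 \<le> ln (real k)) at_top"
      by (simp add: filterlim_at_top)
    then show "eventually (\<lambda>k. norm (real k * ln (real k)) \<le> 4 * norm (real (f k))) at_top"
      using eventually_ge_at_top[of 2]
    proof eventually_elim
      case (elim k)
      have "(real k / 2) * (ln (real k) / 2) \<le> (real k - 1) * (ln (real k) - 1)"
        using elim by (intro mult_mono) auto
      also have "\<dots> \<le> real (f k)"
        using le[of k] elim by simp
      finally show ?case
        using elim by simp
    qed
  qed
  then show ?thesis
    by (simp add: bigomega_iff_bigo)
qed

text \<open>
  If \<open>m\<close> does not exceed the sum, the right vertices can be distributed so that every
  \<open>i \<in> {1..k - 1}\<close> receives at most \<open>(k - 1) div i\<close> of them.  These impose at most \<open>k - 1\<close>
  conditions on the left vertex \<open>k - i\<close> that serves them.  The left vertex \<open>0\<close>, which would belong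
  to \<open>i = k\<close>, serves none, since a single right vertex would impose \<open>k\<close> conditions on it.
\<close>
lemma (in hermitian_product) m_ch_gt_floor_sum:
  assumes "k \<ge> 1"
  shows "int (m_ch ip k) > (\<Sum>i = 1..k - 1. \<lfloor>(real k - 1) / real i\<rfloor>)"
proof (rule ccontr)
  define m where "m = m_ch ip k"
  assume "\<not> int (m_ch ip k) > (\<Sum>i = 1..k - 1. \<lfloor>(real k - 1) / real i\<rfloor>)"
  moreover have "\<lfloor>(real k - 1) / real i\<rfloor> = int ((k - 1) div i)" for i
    using assms floor_divide_of_nat_eq[of "k - 1" i] by (simp add: of_nat_diff)
  ultimately have "int m \<le> int (\<Sum>i = 1..k - 1. (k - 1) div i)"
    by (simp add: m_def)
  then have "m \<le> (\<Sum>i = 1..k - 1. (k - 1) div i)"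
    by linarith
  then obtain s where s: "\<forall>j<m. s j \<in> {1..k - 1}"
    and fibre: "\<forall>i\<in>{1..k - 1}. card {j. j < m \<and> s j = i} \<le> (k - 1) div i"
    by (rule exists_bounded_fibres[OF finite_atLeastAtMost])
  have "subspace_choosable ip (complete_bipartite k m) k"
  proof (rule choosable_of_schedule)
    show "\<forall>j<m. 1 \<le> s j \<and> s j \<le> k"
      using s by auto
    show "\<forall>i. 1 \<le> i \<and> i \<le> k \<longrightarrow> card {j. j < m \<and> s j = i} * i < k"
    proof (intro allI impI)
      fix i assume i: "1 \<le> i \<and> i \<le> k"
      show "card {j. j < m \<and> s j = i} * i < k"
      proof (cases "i = k")
        case True
        then have empty: "{j. j < m \<and> s j = i} = {}"
          using s assms by fastforce
        show ?thesis
          unfolding empty using assms by simp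
      next
        case False
        then have "card {j. j < m \<and> s j = i} * i \<le> (k - 1) div i * i"
          using fibre i by (intro mult_right_mono) auto
        also have "\<dots> \<le> k - 1"
          by simp
        finally show ?thesis
          using assms by linarith
      qed
    qed
  qed
  then have "ch_s ip (complete_bipartite k m) \<le> k"
    unfolding ch_s_def using assms by (intro Least_le) simp
  moreover have "ch_s ip (complete_bipartite k m) = k + 1"
    unfolding m_def m_ch_def by (rule LeastI) (rule ch_s_attains_maximum[OF assms])
  ultimately show False
    by simp
qed

lemma hermitian_product_scalar_prod:
  "hermitian_product (\<lambda>a :: 'a :: field. a) (\<bullet>)"
  by unfold_locales (auto simp: scalar_prod_def lessThan_atLeast0)

lemma hermitian_product_cscalar_prod:
  "hermitian_product cnj (\<bullet>c)"
  by unfold_locales (auto simp: cscalar_prod_complex_eq)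

theorem theorem1p4:
  shows "((\<forall>k \<ge> 1. int (m_ch ((\<bullet>) :: 'a :: field vec \<Rightarrow> 'a vec \<Rightarrow> 'a) k)
              > (\<Sum>i = 1..k - 1. \<lfloor>(real k - 1) / real i\<rfloor>))
          \<and> (\<lambda>k. real (m_ch ((\<bullet>) :: 'a vec \<Rightarrow> 'a vec \<Rightarrow> 'a) k))
              \<in> \<Omega>(\<lambda>k. real k * ln (real k)))
       \<and> ((\<forall>k \<ge> 1. int (m_ch ((\<bullet>c) :: complex vec \<Rightarrow> complex vec \<Rightarrow> complex) k)
              > (\<Sum>i = 1..k - 1. \<lfloor>(real k - 1) / real i\<rfloor>))
          \<and> (\<lambda>k. real (m_ch ((\<bullet>c) :: complex vec \<Rightarrow> complex vec \<Rightarrow> complex) k))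
              \<in> \<Omega>(\<lambda>k. real k * ln (real k)))"
  using hermitian_product.m_ch_gt_floor_sum[OF hermitian_product_scalar_prod]
    hermitian_product.m_ch_gt_floor_sum[OF hermitian_product_cscalar_prod]
  by (intro conjI harmonic_floor_sum_bigomega) auto

end
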